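(* Let $n\geq 2$ and let $A=[a_{ij}]\in \mathbb{C}^{n\times n}$ be a DD matrix. Then $A$ is an H-matrix if and only if $T(A)=\emptyset$ or $A|_{T(A)^2}$ is an H-matrix.
   Context: Let $N=\{1,2,\ldots,n\}$. For $A=[a_{ij}]\in\mathbb{C}^{n\times n}$ and $i\in N$, put $r_i(A)=\sum_{j\in N\setminus\{i\}}|a_{ij}|$. The matrix $A$ is SDD (strictly diagonally dominant) if $|a_{ii}|>r_i(A)$ for all $i\in N$, and DD (diagonally dominant) if $|a_{ii}|\geq r_i(A)$ for all $i\in N$. Let $T(A)=\{i\in N : |a_{ii}|\leq r_i(A)\}$. For a nonempty $S\subseteq N$, $A|_{S^2}$ denotes the principal submatrix of $A$ with rows and columns indexed by $S$. A square complex matrix $B$ is an H-matrix if there exists a diagonal matrix $D$ with positive diagonal entries such that $BD$ is SDD (equivalently, its comparison matrix, with diagonal entries $|b_{ii}|$ and off-diagonal entries $-|b_{ij}|$, is a nonsingular M-matrix). These notions apply also to $1\times 1$ matrices, for which the off-diagonal row sum is $0$; so $[b]$ is an H-matrix if and only if $b\neq 0$. *)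

theory Defs
  imports Complex_Main "Jordan_Normal_Form.Matrix" "Jordan_Normal_Form.DL_Submatrix"
begin

(* Rows and columns are numbered 0, ..., n - 1, as usual for this matrix type,
   so N = {1, ..., n} becomes {0..<dim_row A}. *)

definition offdiag_row_sum :: "complex mat \<Rightarrow> nat \<Rightarrow> real" where
  "offdiag_row_sum A i = (\<Sum>j\<in>{0..<dim_row A} - {i}. cmod (A $$ (i, j)))"

definition SDD :: "complex mat \<Rightarrow> bool" where
  "SDD A \<longleftrightarrow> square_mat A \<and>
     (\<forall>i\<in>{0..<dim_row A}. cmod (A $$ (i, i)) > offdiag_row_sum A i)"

definition DD :: "complex mat \<Rightarrow> bool" where
  "DD A \<longleftrightarrow> square_mat A \<and>
     (\<forall>i\<in>{0..<dim_row A}. cmod (A $$ (i, i)) \<ge> offdiag_row_sum A i)"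

definition non_SDD_rows :: "complex mat \<Rightarrow> nat set" where
  "non_SDD_rows A = {i\<in>{0..<dim_row A}. cmod (A $$ (i, i)) \<le> offdiag_row_sum A i}"

definition principal_submatrix :: "complex mat \<Rightarrow> nat set \<Rightarrow> complex mat" where
  "principal_submatrix A S = submatrix A S S"

definition H_matrix :: "complex mat \<Rightarrow> bool" where
  "H_matrix B \<longleftrightarrow> square_mat B \<and>
     (\<exists>d :: nat \<Rightarrow> real. (\<forall>i\<in>{0..<dim_row B}. d i > 0) \<and>
        SDD (B * mat_diag (dim_row B) (\<lambda>i. complex_of_real (d i))))"

end

theory Submission
  imports Defs
begin

text \<open>
  Being an H-matrix means having a positive weight vector \<open>d\<close> for which every row
  satisfies the strict inequality \<open>\<bar>a\<^sub>i\<^sub>i\<bar> d\<^sub>i > \<Sum> \<bar>a\<^sub>i\<^sub>j\<bar> d\<^sub>j\<close>, the sum being over \<open>j \<noteq> i\<close>.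
  Such weights restrict to any set \<open>S\<close> of indices, since discarding columns only
  decreases the sums; this gives one direction, for every principal submatrix.

  Conversely, let \<open>d\<close> be weights for the rows and columns in \<open>T\<close>, the set of rows that
  are not strictly dominant. Perturb the constant weight \<open>1\<close> of the whole matrix to
  \<open>1 + \<epsilon> d\<^sub>i\<close> on \<open>T\<close>, leaving it equal to \<open>1\<close> elsewhere. A row in \<open>T\<close> has nonnegative
  excess \<open>\<bar>a\<^sub>i\<^sub>i\<bar> - r\<^sub>i\<close> by diagonal dominance, and the perturbation adds \<open>\<epsilon>\<close> times the
  positive excess that \<open>d\<close> provides on \<open>T\<close>, so the row becomes strict for every
  \<open>\<epsilon> > 0\<close>. A row outside \<open>T\<close> is already strict and loses only a multiple of \<open>\<epsilon>\<close>, so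
  it remains strict for small \<open>\<epsilon>\<close>. The case \<open>T = {}\<close> is the one where nothing is
  perturbed.
\<close>

text \<open>
  The rows and columns keep the numbering of the whole matrix: weights for a
  principal submatrix can then be compared with weights for the matrix itself
  without any renumbering.
\<close>

definition weighted_SDD_on :: "nat set \<Rightarrow> complex mat \<Rightarrow> (nat \<Rightarrow> real) \<Rightarrow> bool" where
  "weighted_SDD_on S A d \<longleftrightarrow> (\<forall>i\<in>S. d i > 0) \<and>
     (\<forall>i\<in>S. (\<Sum>j\<in>S - {i}. cmod (A $$ (i, j)) * d j) < cmod (A $$ (i, i)) * d i)"

lemma H_matrix_iff_weighted_SDD_on:
  assumes "B \<in> carrier_mat n n"
  shows "H_matrix B \<longleftrightarrow> (\<exists>d. weighted_SDD_on {0..<n} B d)"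
proof -
  have "SDD (B * mat_diag n (\<lambda>i. complex_of_real (d i))) \<longleftrightarrow>
      (\<forall>i\<in>{0..<n}. (\<Sum>j\<in>{0..<n} - {i}. cmod (B $$ (i, j)) * d j) < cmod (B $$ (i, i)) * d i)"
    if pos: "\<forall>i\<in>{0..<n}. d i > 0" for d :: "nat \<Rightarrow> real"
  proof -
    define C where "C = B * mat_diag n (\<lambda>i. complex_of_real (d i))"
    have C: "C = Matrix.mat n n (\<lambda>(i, j). B $$ (i, j) * complex_of_real (d j))"
      unfolding C_def by (rule mat_diag_mult_right[OF assms])
    have entry: "cmod (C $$ (i, j)) = cmod (B $$ (i, j)) * d j" if "i < n" "j < n" for i j
      using that pos by (auto simp: C norm_mult less_imp_le)
    have "offdiag_row_sum C i = (\<Sum>j\<in>{0..<n} - {i}. cmod (B $$ (i, j)) * d j)" if "i < n" for i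
    proof -
      have "dim_row C = n" by (simp add: C)
      then show ?thesis
        unfolding offdiag_row_sum_def using that by (intro sum.cong) (simp_all add: entry)
    qed
    then have "SDD C \<longleftrightarrow>
        (\<forall>i\<in>{0..<n}. (\<Sum>j\<in>{0..<n} - {i}. cmod (B $$ (i, j)) * d j) < cmod (B $$ (i, i)) * d i)"
      unfolding SDD_def using entry by (simp add: C)
    then show ?thesis unfolding C_def .
  qed
  then show ?thesis
    using assms unfolding H_matrix_def weighted_SDD_on_def by auto
qed

lemma weighted_SDD_on_subset:
  assumes "weighted_SDD_on S A d" "T \<subseteq> S" "finite S"
  shows "weighted_SDD_on T A d"
  unfolding weighted_SDD_on_def
proof (intro conjI ballI)
  fix i assume i: "i \<in> T"
  have pos: "d j > 0" if "j \<in> S" for j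
    using assms(1) that unfolding weighted_SDD_on_def by blast
  from i assms(2) show "d i > 0" by (blast intro: pos)
  have "(\<Sum>j\<in>T - {i}. cmod (A $$ (i, j)) * d j) \<le> (\<Sum>j\<in>S - {i}. cmod (A $$ (i, j)) * d j)"
    using assms(2,3) by (intro sum_mono2) (auto simp: pos less_imp_le)
  also have "\<dots> < cmod (A $$ (i, i)) * d i"
    using assms(1,2) i unfolding weighted_SDD_on_def by blast
  finally show "(\<Sum>j\<in>T - {i}. cmod (A $$ (i, j)) * d j) < cmod (A $$ (i, i)) * d i" .
qed

lemma bij_betw_pick:
  assumes "finite S"
  shows "bij_betw (pick S) {0..<card S} S"
proof -
  have inj: "inj_on (pick S) {0..<card S}"
    by (rule inj_on_inverseI[where g = "\<lambda>x. card {a \<in> S. a < x}"]) (simp add: card_pick_le)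
  have "pick S ` {0..<card S} = S"
    by (rule card_subset_eq) (auto simp: assms card_image[OF inj] pick_in_set_le)
  with inj show ?thesis by (rule bij_betw_imageI)
qed

text \<open>
  The submatrix is indexed by \<open>{0..<card S}\<close>; the increasing enumeration of \<open>S\<close> carries
  weights on \<open>S\<close> to weights on these indices and back.
\<close>

lemma H_matrix_principal_submatrix_iff:
  assumes A: "A \<in> carrier_mat n n" and S: "S \<subseteq> {0..<n}"
  shows "H_matrix (principal_submatrix A S) \<longleftrightarrow> (\<exists>d. weighted_SDD_on S A d)"
proof -
  define B where "B = principal_submatrix A S"
  define p where "p = pick S"
  define m where "m = card S"
  have bij: "bij_betw p {0..<m} S"
    unfolding p_def m_def using S by (intro bij_betw_pick) (auto intro: finite_subset)
  have restr: "{i. i < n \<and> i \<in> S} = S" using S by auto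
  have B: "B \<in> carrier_mat m m"
    unfolding B_def principal_submatrix_def m_def using A restr by (intro carrier_matI) (auto simp: dim_submatrix)
  have entry: "B $$ (i, j) = A $$ (p i, p j)" if "i < m" "j < m" for i j
    using that A restr unfolding B_def principal_submatrix_def p_def m_def
    by (subst submatrix_index) auto
  have transport: "weighted_SDD_on {0..<m} B (d \<circ> p) \<longleftrightarrow> weighted_SDD_on S A d" for d
  proof -
    have ball_S: "(\<forall>i\<in>S. P i) \<longleftrightarrow> (\<forall>i\<in>{0..<m}. P (p i))" for P
      using bij_betw_imp_surj_on[OF bij] by blast
    have "(\<Sum>j\<in>S - {p i}. cmod (A $$ (p i, j)) * d j)
        = (\<Sum>j\<in>{0..<m} - {i}. cmod (B $$ (i, j)) * d (p j))" if "i < m" for i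
    proof -
      have "bij_betw p ({0..<m} - {i}) (S - {p i})"
        using bij that by (intro bij_betw_DiffI) (auto simp: bij_betw_def)
      from sum.reindex_bij_betw[OF this, of "\<lambda>j. cmod (A $$ (p i, j)) * d j"]
      show ?thesis using that by (simp add: entry)
    qed
    then show ?thesis
      unfolding weighted_SDD_on_def ball_S by (simp add: entry)
  qed
  have pull: "(\<exists>e. weighted_SDD_on {0..<m} B e) \<longleftrightarrow> (\<exists>d. weighted_SDD_on {0..<m} B (d \<circ> p))"
  proof
    assume "\<exists>e. weighted_SDD_on {0..<m} B e"
    then obtain e where e: "weighted_SDD_on {0..<m} B e" ..
    have "(e \<circ> inv_into {0..<m} p \<circ> p) i = e i" if "i < m" for i
      using bij that by (simp add: bij_betw_def)
    with e have "weighted_SDD_on {0..<m} B (e \<circ> inv_into {0..<m} p \<circ> p)"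
      unfolding weighted_SDD_on_def by simp
    then show "\<exists>d. weighted_SDD_on {0..<m} B (d \<circ> p)"
      by (rule exI[where x = "e \<circ> inv_into {0..<m} p"])
  qed blast
  show ?thesis
    using H_matrix_iff_weighted_SDD_on[OF B] pull transport unfolding B_def by simp
qed

text \<open>
  Only strictness is missing in the rows of \<open>non_SDD_rows A\<close>, and the rows outside have
  room to spare, so weights \<open>d\<close> on these rows suffice as a first-order correction of the
  constant weight. In the proof, \<open>loss i\<close> is the amount per unit of \<open>\<epsilon>\<close> that the
  correction adds to the off-diagonal sum of row \<open>i\<close>.
\<close>

lemma DD_weighted_SDD_on_extend:
  assumes A: "A \<in> carrier_mat n n" and DD: "DD A"
    and d: "weighted_SDD_on (non_SDD_rows A) A d"
  shows "\<exists>e. weighted_SDD_on {0..<n} A e"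
proof -
  define T where "T = non_SDD_rows A"
  have T: "T \<subseteq> {0..<n}" using A unfolding T_def non_SDD_rows_def by auto
  have dpos: "d i > 0" if "i \<in> T" for i
    using d that unfolding T_def weighted_SDD_on_def by blast
  define loss where "loss i = (\<Sum>j\<in>T - {i}. cmod (A $$ (i, j)) * d j)" for i
  have r: "offdiag_row_sum A i = (\<Sum>j\<in>{0..<n} - {i}. cmod (A $$ (i, j)))" for i
    using A unfolding offdiag_row_sum_def by auto
  have "\<forall>\<^sub>F \<epsilon> in at_right 0. \<forall>i\<in>{0..<n} - T. offdiag_row_sum A i + \<epsilon> * loss i < cmod (A $$ (i, i))"
  proof (intro eventually_ball_finite ballI)
    fix i assume i: "i \<in> {0..<n} - T"
    have "((\<lambda>\<epsilon>. offdiag_row_sum A i + \<epsilon> * loss i) \<longlongrightarrow> offdiag_row_sum A i + 0 * loss i) (at_right 0)"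
      by (intro tendsto_intros)
    moreover have "offdiag_row_sum A i + 0 * loss i < cmod (A $$ (i, i))"
      using i A unfolding T_def non_SDD_rows_def by auto
    ultimately show "\<forall>\<^sub>F \<epsilon> in at_right 0. offdiag_row_sum A i + \<epsilon> * loss i < cmod (A $$ (i, i))"
      by (rule order_tendstoD)
  qed simp
  moreover have "\<forall>\<^sub>F \<epsilon> :: real in at_right 0. \<epsilon> > 0"
    by (rule eventually_at_right_less)
  ultimately have "\<forall>\<^sub>F \<epsilon> in at_right 0. \<epsilon> > 0 \<and>
      (\<forall>i\<in>{0..<n} - T. offdiag_row_sum A i + \<epsilon> * loss i < cmod (A $$ (i, i)))"
    by eventually_elim simp
  then obtain \<epsilon> :: real where \<epsilon>: "\<epsilon> > 0"
    and outside: "\<And>i. i \<in> {0..<n} - T \<Longrightarrow> offdiag_row_sum A i + \<epsilon> * loss i < cmod (A $$ (i, i))"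
    using eventually_happens'[OF trivial_limit_at_right_real] by blast
  define e where "e i = (if i \<in> T then 1 + \<epsilon> * d i else 1)" for i
  have row: "(\<Sum>j\<in>{0..<n} - {i}. cmod (A $$ (i, j)) * e j) = offdiag_row_sum A i + \<epsilon> * loss i" for i
  proof -
    have "(\<Sum>j\<in>{0..<n} - {i}. cmod (A $$ (i, j)) * e j)
        = (\<Sum>j\<in>{0..<n} - {i}. cmod (A $$ (i, j))
            + (if j \<in> T then \<epsilon> * (cmod (A $$ (i, j)) * d j) else 0))"
      by (intro sum.cong) (auto simp: e_def algebra_simps)
    also have "\<dots> = offdiag_row_sum A i
        + (\<Sum>j\<in>({0..<n} - {i}) \<inter> T. \<epsilon> * (cmod (A $$ (i, j)) * d j))"
      by (simp add: sum.distrib r sum.inter_restrict)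
    also have "({0..<n} - {i}) \<inter> T = T - {i}" using T by auto
    finally show ?thesis by (simp add: loss_def sum_distrib_left)
  qed
  have "weighted_SDD_on {0..<n} A e"
    unfolding weighted_SDD_on_def row
  proof (intro conjI ballI)
    fix i assume i: "i \<in> {0..<n}"
    show "e i > 0" using dpos[of i] \<epsilon> by (auto simp: e_def add_pos_pos)
    show "offdiag_row_sum A i + \<epsilon> * loss i < cmod (A $$ (i, i)) * e i"
    proof (cases "i \<in> T")
      case True
      have "offdiag_row_sum A i \<le> cmod (A $$ (i, i))"
        using DD i A unfolding DD_def by auto
      moreover have "loss i < cmod (A $$ (i, i)) * d i"
        using d True unfolding loss_def T_def weighted_SDD_on_def by blast
      then have "\<epsilon> * loss i < \<epsilon> * (cmod (A $$ (i, i)) * d i)"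
        using \<epsilon> by (rule mult_strict_left_mono)
      ultimately show ?thesis using True by (simp add: e_def algebra_simps)
    next
      case False
      then show ?thesis using outside[of i] i by (simp add: e_def)
    qed
  qed
  then show ?thesis by blast
qed

theorem theorem7:
  fixes A :: "complex mat" and n :: nat
  assumes "n \<ge> 2"
    and "A \<in> carrier_mat n n"
    and "DD A"
  shows "H_matrix A \<longleftrightarrow>
    non_SDD_rows A = {} \<or> H_matrix (principal_submatrix A (non_SDD_rows A))"
proof -
  let ?T = "non_SDD_rows A"
  have T: "?T \<subseteq> {0..<n}" using assms(2) unfolding non_SDD_rows_def by auto
  have "H_matrix A \<longleftrightarrow> (\<exists>d. weighted_SDD_on {0..<n} A d)"
    by (rule H_matrix_iff_weighted_SDD_on[OF assms(2)])
  also have "\<dots> \<longleftrightarrow> (\<exists>d. weighted_SDD_on ?T A d)"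
    using weighted_SDD_on_subset[OF _ T] DD_weighted_SDD_on_extend[OF assms(2,3)] by auto
  also have "\<dots> \<longleftrightarrow> H_matrix (principal_submatrix A ?T)"
    by (rule H_matrix_principal_submatrix_iff[OF assms(2) T, symmetric])
  \<comment> \<open>The empty submatrix is an H-matrix, so the first alternative is part of the second.\<close>
  also have "\<dots> \<longleftrightarrow> ?T = {} \<or> H_matrix (principal_submatrix A ?T)"
    using H_matrix_principal_submatrix_iff[OF assms(2) T] by (auto simp: weighted_SDD_on_def)
  finally show ?thesis .
qed

end
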